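(* $\mathcal{P}_{\Pi_n}$ is the Birkhoff polytope $B_n$. The $d$-dimensional faces of $B_n$ are the $d$-dimensional polytopes of magic labelings of positive digraphs with $n$ vertices and at most $2n+d-1$ edges. The vertices of $\mathcal{P}_D$, where $D$ is a positive digraph with $n$ vertices, are permutation matrices.
   Context: The Birkhoff polytope $B_n$ is the set of $n\times n$ nonnegative real matrices all of whose rows and columns sum to $1$. Digraphs are finite, loops are allowed, and there is at most one edge $e_{ij}$ from vertex $v_i$ to vertex $v_j$ for each ordered pair $(i,j)$. $\Pi_n$ is the complete digraph on $v_1,\dots,v_n$: there is an edge $e_{ij}$ for every ordered pair $(i,j)$, including a loop at every vertex. Every digraph with $n$ vertices is regarded as a subdigraph of $\Pi_n$. For a digraph $D$ with $q$ edges, the polytope of magic labelings $\mathcal{P}_D\subseteq\mathbb{R}^q$ is the set of nonnegative real labelings of the edges of $D$ such that at every vertex the labels of the outgoing edges sum to $1$ and the labels of the incoming edges sum to $1$. A labeling $L$ of a digraph with $n$ vertices is identified with the $n\times n$ matrix $[m_{ij}]$, $m_{ij}=L(e_{ij})$ if $e_{ij}$ is an edge and $m_{ij}=0$ otherwise; thus each $\mathcal{P}_D$ is viewed inside $\mathbb{R}^{n^2}$. $G_D$ is the bipartite graph on $a_1,\dots,a_n,b_1,\dots,b_n$ with an edge $a_ib_j$ if and only if $e_{ij}$ is an edge of $D$. A graph $G$ is positive if for every edge $e$ there is an assignment $L$ of nonnegative integers to the edges of $G$ with all vertex sums equal and $L(e)>0$; $D$ is positive if $G_D$ is positive. Faces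 are nonempty. *)

theory Defs
  imports "HOL-Analysis.Analysis"
begin

text \<open>
  The vertex set is the finite type \<open>'n\<close>, so \<open>n = CARD('n) \<ge> 1\<close>. A digraph on it is its set of
  edges, the pair \<open>(i, j)\<close> being the edge from \<open>i\<close> to \<open>j\<close>; loops are allowed, and every
  digraph has all of \<open>'n\<close> as its vertices (some possibly isolated).
\<close>

type_synonym 'n digraph = "('n \<times> 'n) set"

definition complete_digraph :: "'n digraph" where
  "complete_digraph = UNIV"

definition birkhoff_polytope :: "(real ^ 'n ^ 'n) set" where
  "birkhoff_polytope = {M. (\<forall>i j. M $ i $ j \<ge> 0) \<and>
     (\<forall>i. (\<Sum>j\<in>UNIV. M $ i $ j) = 1) \<and> (\<forall>j. (\<Sum>i\<in>UNIV. M $ i $ j) = 1)}"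

text \<open>
  Labelings are total functions of which only the values on the edges of \<open>D\<close> matter: all
  conditions below, and the matrix of a labeling, ignore the values elsewhere.
\<close>

definition magic_labeling :: "'n digraph \<Rightarrow> ('n \<times> 'n \<Rightarrow> real) \<Rightarrow> bool" where
  "magic_labeling D L \<longleftrightarrow> (\<forall>e\<in>D. L e \<ge> 0) \<and>
     (\<forall>v. (\<Sum>e | e \<in> D \<and> fst e = v. L e) = 1) \<and>
     (\<forall>v. (\<Sum>e | e \<in> D \<and> snd e = v. L e) = 1)"

definition labeling_matrix :: "'n digraph \<Rightarrow> ('n \<times> 'n \<Rightarrow> real) \<Rightarrow> real ^ 'n ^ 'n" where
  "labeling_matrix D L = (\<chi> i j. if (i, j) \<in> D then L (i, j) else 0)"

definition magic_polytope :: "'n digraph \<Rightarrow> (real ^ 'n ^ 'n) set" where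
  "magic_polytope D = labeling_matrix D ` {L. magic_labeling D L}"

text \<open>An undirected graph is given by its vertices and by its edges as sets of endpoints.\<close>

definition positive_graph :: "'a set \<Rightarrow> 'a set set \<Rightarrow> bool" where
  "positive_graph V E \<longleftrightarrow> (\<forall>e\<in>E. \<exists>L :: 'a set \<Rightarrow> nat.
     (\<exists>r. \<forall>v\<in>V. (\<Sum>e' | e' \<in> E \<and> v \<in> e'. L e') = r) \<and> L e > 0)"

text \<open>In the bipartite graph of a digraph, \<open>Inl i\<close> is \<open>a\<^sub>i\<close> and \<open>Inr j\<close> is \<open>b\<^sub>j\<close>.\<close>

definition bipartite_edges :: "'n digraph \<Rightarrow> ('n + 'n) set set" where
  "bipartite_edges D = {{Inl i, Inr j} | i j. (i, j) \<in> D}"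

definition positive_digraph :: "'n digraph \<Rightarrow> bool" where
  "positive_digraph D \<longleftrightarrow> positive_graph UNIV (bipartite_edges D)"

definition permutation_matrix :: "real ^ 'n ^ 'n \<Rightarrow> bool" where
  "permutation_matrix M \<longleftrightarrow>
     (\<exists>p. p permutes UNIV \<and> M = (\<chi> i j. if j = p i then 1 else 0))"

end

theory Submission
  imports Defs
begin

text \<open>
  The matrices supported on a nonempty edge set \<open>D\<close> whose row and column sums vanish form a space
  of dimension at least \<open>|D| - (r + c - 1)\<close>, where \<open>r\<close> and \<open>c\<close> count the rows and columns that \<open>D\<close>
  meets: one of the \<open>r + c\<close> constraints is redundant. If a doubly stochastic matrix has fractional
  entries, each row and column meeting them contains at least two, so \<open>r + c \<le> |D|\<close> for the set \<open>D\<close>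
  of their positions, and the matrix can be moved both ways along a nonzero direction; hence the
  extreme points are permutation matrices. A face is the set of all doubly stochastic matrices
  supported on the union \<open>D\<close> of the supports of its points; it has a point positive on all of \<open>D\<close>,
  around which every direction as above is feasible, and this bounds \<open>|D|\<close> by the dimension.
  Positivity of \<open>D\<close> follows from Krein--Milman, since each edge of \<open>D\<close> lies in the support of
  an extreme point.
\<close>

section \<open>Polytopes of magic labelings as faces of the Birkhoff polytope\<close>

text \<open>The vertex sums of a labeling are the row and column sums of its matrix, so everything
  below can be argued with matrices alone.\<close>

lemma magic_polytope_eq:
  "magic_polytope D = {M \<in> birkhoff_polytope. \<forall>i j. (i, j) \<notin> D \<longrightarrow> M $ i $ j = 0}"
  for D :: "'n::finite digraph"
proof -
  have row: "(\<Sum>e | e \<in> D \<and> fst e = v. L e) = (\<Sum>j\<in>UNIV. labeling_matrix D L $ v $ j)"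
    and col: "(\<Sum>e | e \<in> D \<and> snd e = v. L e) = (\<Sum>i\<in>UNIV. labeling_matrix D L $ i $ v)" for L v
  proof -
    have "(\<Sum>e | e \<in> D \<and> fst e = v. L e) = (\<Sum>j | (v, j) \<in> D. L (v, j))"
      by (rule sum.reindex_bij_witness[of _ "\<lambda>j. (v, j)" snd]) auto
    then show "(\<Sum>e | e \<in> D \<and> fst e = v. L e) = (\<Sum>j\<in>UNIV. labeling_matrix D L $ v $ j)"
      by (simp add: labeling_matrix_def sum.If_cases)
    have "(\<Sum>e | e \<in> D \<and> snd e = v. L e) = (\<Sum>i | (i, v) \<in> D. L (i, v))"
      by (rule sum.reindex_bij_witness[of _ "\<lambda>i. (i, v)" fst]) auto
    then show "(\<Sum>e | e \<in> D \<and> snd e = v. L e) = (\<Sum>i\<in>UNIV. labeling_matrix D L $ i $ v)"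
      by (simp add: labeling_matrix_def sum.If_cases)
  qed
  have magic: "magic_labeling D L \<longleftrightarrow> labeling_matrix D L \<in> birkhoff_polytope" for L
    unfolding magic_labeling_def birkhoff_polytope_def row col
    by (auto simp: labeling_matrix_def)
  show ?thesis
  proof safe
    fix M assume "M \<in> birkhoff_polytope" and supp: "\<forall>i j. (i, j) \<notin> D \<longrightarrow> M $ i $ j = 0"
    moreover have "labeling_matrix D (\<lambda>(i, j). M $ i $ j) = M"
      using supp by (simp add: labeling_matrix_def vec_eq_iff)
    ultimately show "M \<in> magic_polytope D"
      unfolding magic_polytope_def magic by (metis (mono_tags) image_eqI mem_Collect_eq)
  qed (auto simp: magic_polytope_def magic labeling_matrix_def)
qed

lemma birkhoff_polytope_nonneg: "M \<in> birkhoff_polytope \<Longrightarrow> 0 \<le> M $ i $ j"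
  by (simp add: birkhoff_polytope_def)

lemma birkhoff_polytope_le_1:
  assumes "M \<in> birkhoff_polytope"
  shows "M $ i $ j \<le> 1"
proof -
  have "M $ i $ j \<le> (\<Sum>j\<in>UNIV. M $ i $ j)"
    using assms by (intro member_le_sum) (auto simp: birkhoff_polytope_def)
  then show ?thesis using assms by (simp add: birkhoff_polytope_def)
qed

lemma convex_birkhoff_polytope: "convex birkhoff_polytope"
  unfolding convex_def birkhoff_polytope_def
  by (auto simp: sum.distrib simp flip: sum_distrib_left)

lemma compact_magic_polytope: "compact (magic_polytope D)" for D :: "'n::finite digraph"
proof -
  have "magic_polytope D \<subseteq> cbox 0 1"
    unfolding magic_polytope_eq
    by (auto simp: mem_box_cart birkhoff_polytope_nonneg birkhoff_polytope_le_1
      interval_cbox_cart one_vec_def less_eq_vec_def mem_box Basis_vec_def inner_axis)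
  then have "bounded (magic_polytope D)"
    using bounded_cbox bounded_subset by blast
  moreover have "magic_polytope D = (\<Inter>i. \<Inter>j. {M. 0 \<le> M $ i $ j}) \<inter>
      (\<Inter>i. {M. (\<Sum>j\<in>UNIV. M $ i $ j) = 1}) \<inter> (\<Inter>j. {M. (\<Sum>i\<in>UNIV. M $ i $ j) = 1}) \<inter>
      (\<Inter>(i, j)\<in>- D. {M. M $ i $ j = 0})"
    by (auto simp: magic_polytope_eq birkhoff_polytope_def)
  then have "closed (magic_polytope D)"
    by (auto intro!: closed_Collect_le closed_Collect_eq continuous_intros)
  ultimately show ?thesis by (simp add: compact_eq_bounded_closed)
qed

text \<open>A combination of two nonnegative entries with positive weights is zero only if both
  entries are zero. The empty set counts as a face here.\<close>

lemma magic_polytope_face_of_birkhoff: "magic_polytope D face_of birkhoff_polytope"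
  for D :: "'n::finite digraph"
  unfolding face_of_def
proof (intro conjI ballI impI)
  show "magic_polytope D \<subseteq> birkhoff_polytope" by (auto simp: magic_polytope_eq)
  show "convex (magic_polytope D)"
    using convex_birkhoff_polytope unfolding convex_def magic_polytope_eq by auto
next
  fix a b x :: "real ^ 'n ^ 'n"
  assume a: "a \<in> birkhoff_polytope" and b: "b \<in> birkhoff_polytope"
    and x: "x \<in> magic_polytope D" and seg: "x \<in> open_segment a b"
  obtain u where u: "0 < u" "u < 1" "x = (1 - u) *\<^sub>R a + u *\<^sub>R b"
    using seg by (auto simp: in_segment)
  have "a $ i $ j = 0 \<and> b $ i $ j = 0" if "(i, j) \<notin> D" for i j
  proof -
    have "(1 - u) * a $ i $ j + u * b $ i $ j = 0"
      using x that u by (auto simp: magic_polytope_eq)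
    moreover have "0 \<le> a $ i $ j" "0 \<le> b $ i $ j"
      using a b by (auto simp: birkhoff_polytope_def)
    ultimately show ?thesis
      using u by (simp add: add_nonneg_eq_0_iff)
  qed
  then show "a \<in> magic_polytope D" "b \<in> magic_polytope D"
    using a b by (auto simp: magic_polytope_eq)
qed

section \<open>Zero-sum matrices and their dimension\<close>

text \<open>The directions that preserve all row and column sums. They are the real circulations of
  the bipartite graph of \<open>D\<close> with every edge oriented from its row vertex to its column
  vertex.\<close>

definition zero_sum_matrices :: "'n digraph \<Rightarrow> (real ^ 'n ^ 'n) set" where
  "zero_sum_matrices D = {M. (\<forall>i j. (i, j) \<notin> D \<longrightarrow> M $ i $ j = 0) \<and>
     (\<forall>i. (\<Sum>j\<in>UNIV. M $ i $ j) = 0) \<and> (\<forall>j. (\<Sum>i\<in>UNIV. M $ i $ j) = 0)}"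

lemma subspace_supported_matrices:
  "subspace {M :: real ^ 'n ^ 'n. \<forall>i j. (i, j) \<notin> D \<longrightarrow> M $ i $ j = 0}"
  by (auto simp: subspace_def)

lemma card_le_dim_supported_matrices:
  "card D \<le> dim {M :: real ^ 'n ^ 'n. \<forall>i j. (i, j) \<notin> D \<longrightarrow> M $ i $ j = 0}"
  for D :: "'n::finite digraph"
proof -
  define E :: "'n \<times> 'n \<Rightarrow> real ^ 'n ^ 'n" where "E = (\<lambda>(i, j). axis i (axis j 1))"
  have "inj E" by (auto simp: inj_def E_def axis_eq_axis)
  moreover have "E ` D \<subseteq> Basis" by (auto simp: E_def Basis_vec_def)
  then have "independent (E ` D)" using independent_Basis independent_mono by blast
  moreover have "E ` D \<subseteq> {M. \<forall>i j. (i, j) \<notin> D \<longrightarrow> M $ i $ j = 0}"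
    by (auto simp: E_def axis_def)
  ultimately show ?thesis
    by (metis (no_types, lifting) card_image independent_card_le_dim inj_on_subset subset_UNIV)
qed

text \<open>Zero-sum matrices form the orthogonal complement, among the matrices supported on
  \<open>D\<close>, of the row and column indicators. The additive form avoids subtraction on
  naturals.\<close>

lemma dim_zero_sum_matrices:
  fixes D :: "'n::finite digraph"
  assumes "D \<noteq> {}"
  shows "card D + 1 \<le> dim (zero_sum_matrices D) + card (fst ` D) + card (snd ` D)"
proof -
  let ?S = "{M :: real ^ 'n ^ 'n. \<forall>i j. (i, j) \<notin> D \<longrightarrow> M $ i $ j = 0}"
  \<comment> \<open>\<open>j0\<close> is the column whose constraint will be left out.\<close>
  obtain j0 where j0: "j0 \<in> snd ` D" using assms by auto
  \<comment> \<open>Cutting the indicators down to \<open>D\<close> puts them into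
    \<open>?S\<close>, where their inner products with \<open>M\<close> are still the full row and
    column sums.\<close>
  define r :: "'n \<Rightarrow> real ^ 'n ^ 'n"
    where "r i = (\<chi> a b. if a = i \<and> (a, b) \<in> D then 1 else 0)" for i
  define c :: "'n \<Rightarrow> real ^ 'n ^ 'n"
    where "c j = (\<chi> a b. if b = j \<and> (a, b) \<in> D then 1 else 0)" for j
  let ?G = "r ` fst ` D \<union> c ` (snd ` D - {j0})"
  have r: "r i \<bullet> M = (\<Sum>j\<in>UNIV. M $ i $ j)" if "M \<in> ?S" for i M
  proof -
    have "r i \<bullet> M = (\<Sum>a\<in>UNIV. if a = i then \<Sum>b\<in>UNIV. M $ a $ b else 0)"
      unfolding inner_vec_def r_def using that
      by (intro sum.cong refl) (auto intro!: sum.cong)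
    then show ?thesis by simp
  qed
  have c: "c j \<bullet> M = (\<Sum>i\<in>UNIV. M $ i $ j)" if "M \<in> ?S" for j M
  proof -
    have "c j \<bullet> M = (\<Sum>a\<in>UNIV. \<Sum>b\<in>UNIV. if b = j then M $ a $ b else 0)"
      unfolding inner_vec_def c_def using that
      by (intro sum.cong refl) (auto intro!: sum.cong)
    then show ?thesis by simp
  qed
  have zero_sum: "M \<in> zero_sum_matrices D" if M: "M \<in> ?S" "\<forall>x\<in>span ?G. orthogonal x M" for M
  proof -
    have G: "x \<bullet> M = 0" if "x \<in> ?G" for x
      using M(2) span_base[OF that] by (simp add: orthogonal_def)
    have rows: "(\<Sum>j\<in>UNIV. M $ i $ j) = 0" for i
    proof (cases "i \<in> fst ` D")
      case True
      then show ?thesis using G[of "r i"] r[OF M(1)] by auto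
    next
      case False
      then have "M $ i $ j = 0" for j using M(1) by force
      then show ?thesis by simp
    qed
    have cols': "(\<Sum>i\<in>UNIV. M $ i $ j) = 0" if "j \<noteq> j0" for j
    proof (cases "j \<in> snd ` D")
      case True
      then show ?thesis using that G[of "c j"] c[OF M(1)] by auto
    next
      case False
      then have "M $ i $ j = 0" for i using M(1) by force
      then show ?thesis by simp
    qed
    \<comment> \<open>All column sums together equal all row sums together, so the omitted column
      sum vanishes with the others.\<close>
    have "(\<Sum>j\<in>UNIV. \<Sum>i\<in>UNIV. M $ i $ j) = 0"
      using rows sum.swap[of "\<lambda>i j. M $ i $ j" UNIV UNIV] by simp
    then have "(\<Sum>i\<in>UNIV. M $ i $ j0) = 0"
      using cols' by (simp add: sum.remove[of UNIV j0])
    then have "(\<Sum>i\<in>UNIV. M $ i $ j) = 0" for j using cols' by (cases "j = j0") auto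
    then show ?thesis using M(1) rows by (simp add: zero_sum_matrices_def)
  qed
  have "?G \<subseteq> ?S" by (auto simp: r_def c_def)
  then have GS: "span ?G \<subseteq> ?S" by (rule span_minimal[OF _ subspace_supported_matrices])
  have "dim ?S = dim {y \<in> ?S. \<forall>x\<in>span ?G. orthogonal x y} + dim (span ?G)"
    using dim_subspace_orthogonal_to_vectors[OF subspace_span subspace_supported_matrices GS]
    by (rule sym)
  moreover have "dim {y \<in> ?S. \<forall>x\<in>span ?G. orthogonal x y} \<le> dim (zero_sum_matrices D)"
    using zero_sum by (intro dim_subset) blast
  moreover have "dim (span ?G) \<le> card (fst ` D) + (card (snd ` D) - 1)"
  proof -
    have "dim (span ?G) \<le> card ?G" by (simp add: dim_le_card')
    also have "\<dots> \<le> card (r ` fst ` D) + card (c ` (snd ` D - {j0}))" by (rule card_Un_le)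
    also have "\<dots> \<le> card (fst ` D) + card (snd ` D - {j0})"
      by (intro add_mono card_image_le) auto
    finally show ?thesis using j0 by (simp add: card_Diff_singleton)
  qed
  moreover have "0 < card (snd ` D)" using j0 by (auto simp: card_gt_0_iff)
  ultimately show ?thesis using card_le_dim_supported_matrices[of D] by linarith
qed

section \<open>Perturbation inside the Birkhoff polytope\<close>

text \<open>Where \<open>w\<close> is nonzero, \<open>x\<close> is positive, so each entry tolerates
  a positive step in either direction. The least of these finitely many steps serves for all
  entries.\<close>

lemma birkhoff_perturb:
  fixes x w :: "real ^ 'n ^ 'n"
  assumes x: "x \<in> birkhoff_polytope" and w: "w \<in> zero_sum_matrices {(i, j). 0 < x $ i $ j}"
  obtains e where "0 < e" "\<And>t. \<bar>t\<bar> \<le> e \<Longrightarrow> x + t *\<^sub>R w \<in> birkhoff_polytope"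
proof -
  have "\<exists>e>0. e * \<bar>w $ fst p $ snd p\<bar> \<le> x $ fst p $ snd p" for p
  proof (cases "w $ fst p $ snd p = 0")
    case True
    then show ?thesis using x by (auto intro!: exI[of _ 1] simp: birkhoff_polytope_def)
  next
    case False
    then have "0 < x $ fst p $ snd p" using w by (auto simp: zero_sum_matrices_def)
    then show ?thesis
      using False by (intro exI[of _ "x $ fst p $ snd p / \<bar>w $ fst p $ snd p\<bar>"]) simp
  qed
  then obtain f where f: "\<And>p. 0 < f p" "\<And>p. f p * \<bar>w $ fst p $ snd p\<bar> \<le> x $ fst p $ snd p"
    by metis
  define e where "e = Min (range f)"
  have le: "e \<le> f p" for p unfolding e_def by simp
  have "0 < e" unfolding e_def using f(1) by simp
  moreover have "x + t *\<^sub>R w \<in> birkhoff_polytope" if t: "\<bar>t\<bar> \<le> e" for t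
  proof -
    have "0 \<le> x $ i $ j + t * w $ i $ j" for i j
    proof -
      have "\<bar>t * w $ i $ j\<bar> \<le> f (i, j) * \<bar>w $ i $ j\<bar>"
        unfolding abs_mult using t le[of "(i, j)"] by (intro mult_right_mono) auto
      also have "\<dots> \<le> x $ i $ j" using f(2)[of "(i, j)"] by simp
      finally show ?thesis by linarith
    qed
    then show ?thesis
      using x w by (simp add: birkhoff_polytope_def zero_sum_matrices_def sum.distrib
        flip: sum_distrib_left)
  qed
  ultimately show thesis using that by blast
qed

lemma zero_sum_matrices_mono: "A \<subseteq> B \<Longrightarrow> zero_sum_matrices A \<subseteq> zero_sum_matrices B"
  by (auto simp: zero_sum_matrices_def)

section \<open>Extreme points are permutation matrices\<close>

text \<open>The other values sum to \<open>1 - f a\<close>, which is positive, so one of them is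
  positive; it is at most \<open>1 - f a\<close>, hence below 1.\<close>

lemma fractional_not_alone:
  fixes f :: "'a::finite \<Rightarrow> real"
  assumes "\<And>a. 0 \<le> f a" "(\<Sum>a\<in>UNIV. f a) = 1" "0 < f a" "f a < 1"
  shows "\<exists>b. b \<noteq> a \<and> 0 < f b \<and> f b < 1"
proof -
  have s: "(\<Sum>b\<in>UNIV - {a}. f b) = 1 - f a"
    using assms(2) by (simp add: sum.remove[of UNIV a])
  then obtain b where b: "b \<in> UNIV - {a}" "f b \<noteq> 0"
    using assms(4) by (metis diff_gt_0_iff_gt less_irrefl sum.neutral)
  then have "f b \<le> 1 - f a"
    using s member_le_sum[of b "UNIV - {a}" f] assms(1) by simp
  then show ?thesis using b assms(1)[of b] assms(3) by (intro exI[of _ b]) auto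
qed

lemma two_card_image_le:
  assumes "finite A" "\<And>x. x \<in> A \<Longrightarrow> \<exists>y\<in>A. y \<noteq> x \<and> f y = f x"
  shows "2 * card (f ` A) \<le> card A"
proof -
  have "2 \<le> card {x \<in> A. f x = b}" if "b \<in> f ` A" for b
  proof -
    obtain x y where "x \<in> A" "y \<in> A" "y \<noteq> x" "f x = b" "f y = b"
      using assms(2) \<open>b \<in> f ` A\<close> by (metis imageE)
    then have "card {x, y} \<le> card {x \<in> A. f x = b}" using assms(1) by (intro card_mono) auto
    then show ?thesis using \<open>y \<noteq> x\<close> by simp
  qed
  then have "(\<Sum>b\<in>f ` A. 2) \<le> (\<Sum>b\<in>f ` A. card {x \<in> A. f x = b})" by (rule sum_mono)
  also have "\<dots> = card A" using sum.image_gen[OF assms(1), of "\<lambda>_. 1 :: nat" f] by simp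
  finally show ?thesis by (simp add: mult.commute)
qed

lemma extreme_point_birkhoff_integral:
  fixes M :: "real ^ 'n ^ 'n"
  assumes M: "M extreme_point_of birkhoff_polytope"
  shows "M $ i $ j = 0 \<or> M $ i $ j = 1"
proof (rule ccontr)
  assume nonint: "\<not> ?thesis"
  define D where "D = {(i, j). 0 < M $ i $ j \<and> M $ i $ j < 1}"
  have B: "M \<in> birkhoff_polytope" using M by (simp add: extreme_point_of_def)
  have "(i, j) \<in> D"
    using nonint birkhoff_polytope_nonneg[OF B, of i j] birkhoff_polytope_le_1[OF B, of i j]
    by (auto simp: D_def)
  then have "D \<noteq> {}" by auto
  have "\<exists>q\<in>D. q \<noteq> p \<and> fst q = fst p" if "p \<in> D" for p
  proof -
    have "\<exists>b. b \<noteq> snd p \<and> 0 < M $ fst p $ b \<and> M $ fst p $ b < 1"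
      using B that by (intro fractional_not_alone) (auto simp: D_def birkhoff_polytope_def)
    then obtain b where "b \<noteq> snd p" "0 < M $ fst p $ b" "M $ fst p $ b < 1" by blast
    then show ?thesis by (intro bexI[of _ "(fst p, b)"]) (auto simp: D_def prod_eq_iff)
  qed
  then have rows: "2 * card (fst ` D) \<le> card D" by (intro two_card_image_le) auto
  have "\<exists>q\<in>D. q \<noteq> p \<and> snd q = snd p" if "p \<in> D" for p
  proof -
    have "\<exists>a. a \<noteq> fst p \<and> 0 < M $ a $ snd p \<and> M $ a $ snd p < 1"
      using B that by (intro fractional_not_alone[where f = "\<lambda>a. M $ a $ snd p"])
        (auto simp: D_def birkhoff_polytope_def)
    then obtain a where "a \<noteq> fst p" "0 < M $ a $ snd p" "M $ a $ snd p < 1" by blast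
    then show ?thesis by (intro bexI[of _ "(a, snd p)"]) (auto simp: D_def prod_eq_iff)
  qed
  then have "2 * card (snd ` D) \<le> card D" by (intro two_card_image_le) auto
  \<comment> \<open>Adding the two bounds, \<open>D\<close> meets at most \<open>card D\<close> rows
    and columns together. The \<open>+ 1\<close> from the redundant constraint then forces a
    positive dimension.\<close>
  with rows have "0 < dim (zero_sum_matrices D)"
    using dim_zero_sum_matrices[OF \<open>D \<noteq> {}\<close>] by linarith
  then obtain w where w: "w \<in> zero_sum_matrices D" "w \<noteq> 0"
    by (metis dim_eq_0 less_irrefl subsetI singleton_iff)
  have "D \<subseteq> {(i, j). 0 < M $ i $ j}" by (auto simp: D_def)
  then have "w \<in> zero_sum_matrices {(i, j). 0 < M $ i $ j}"
    using w(1) zero_sum_matrices_mono by blast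
  then obtain e where e: "0 < e" "\<And>t. \<bar>t\<bar> \<le> e \<Longrightarrow> M + t *\<^sub>R w \<in> birkhoff_polytope"
    using birkhoff_perturb[OF B] by metis
  have "M = midpoint (M + (- e) *\<^sub>R w) (M + e *\<^sub>R w)"
    by (simp add: midpoint_def algebra_simps flip: scaleR_2)
  moreover have "M + (- e) *\<^sub>R w \<noteq> M + e *\<^sub>R w"
    using w(2) e(1) by (simp add: neg_eq_iff_add_eq_0 flip: scaleR_minus_left)
  ultimately have "M \<in> open_segment (M + (- e) *\<^sub>R w) (M + e *\<^sub>R w)"
    by (metis midpoint_in_open_segment)
  moreover have "M + (- e) *\<^sub>R w \<in> birkhoff_polytope" "M + e *\<^sub>R w \<in> birkhoff_polytope"
    using e(1) by (auto intro!: e(2) simp del: scaleR_minus_left)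
  ultimately show False using M unfolding extreme_point_of_def by blast
qed

lemma extreme_point_birkhoff_permutation:
  fixes M :: "real ^ 'n ^ 'n"
  assumes M: "M extreme_point_of birkhoff_polytope"
  shows "permutation_matrix M"
proof -
  note int = extreme_point_birkhoff_integral[OF M]
  have sums: "(\<Sum>j\<in>UNIV. M $ i $ j) = 1" "(\<Sum>i\<in>UNIV. M $ i $ j) = 1" for i j
    using M by (auto simp: extreme_point_of_def birkhoff_polytope_def)
  \<comment> \<open>Rewriting a 0/1-valued function as an indicator turns its sum into a
    cardinality.\<close>
  have bool: "f = (\<lambda>a. if f a = 1 then 1 else 0)" if "\<And>a. f a = 0 \<or> f a = 1"
    for f :: "'n \<Rightarrow> real"
    using that by fastforce
  have "(\<Sum>j\<in>UNIV. M $ i $ j) = real (card {j. M $ i $ j = 1})" for i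
    by (subst bool[of "\<lambda>j. M $ i $ j"]) (use int in \<open>auto simp: sum.If_cases\<close>)
  then have "\<exists>b. {j. M $ i $ j = 1} = {b}" for i
    using sums(1)[of i] by (simp add: card_1_singleton_iff)
  then obtain p where "\<And>i. {j. M $ i $ j = 1} = {p i}" by metis
  then have p: "M $ i $ j = 1 \<longleftrightarrow> j = p i" for i j by blast
  have "(\<Sum>i\<in>UNIV. M $ i $ j) = real (card {i. M $ i $ j = 1})" for j
    by (subst bool[of "\<lambda>i. M $ i $ j"]) (use int in \<open>auto simp: sum.If_cases\<close>)
  then have col: "\<exists>a. {i. M $ i $ j = 1} = {a}" for j
    using sums(2)[of j] by (simp add: card_1_singleton_iff)
  \<comment> \<open>Rows having exactly one 1 gave the function \<open>p\<close>; columns having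
    exactly one 1 make it injective.\<close>
  have "inj p"
  proof (rule injI)
    fix a b assume eq: "p a = p b"
    obtain c where "{i. M $ i $ p b = 1} = {c}" using col[of "p b"] by blast
    moreover have "a \<in> {i. M $ i $ p b = 1}" "b \<in> {i. M $ i $ p b = 1}"
      using p[of a "p b"] p[of b "p b"] eq by auto
    ultimately show "a = b" by (metis singletonD)
  qed
  then have "bij p" by (simp add: bij_def finite_UNIV_inj_surj)
  then have "p permutes UNIV" by (intro bij_imp_permutes) auto
  moreover have "M = (\<chi> i j. if j = p i then 1 else 0)"
    using int p by (auto simp: vec_eq_iff)
  ultimately show ?thesis unfolding permutation_matrix_def by blast
qed

text \<open>An extreme point of a face is an extreme point of the whole polytope.\<close>

lemma extreme_point_magic_permutation:
  fixes D :: "'n::finite digraph"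
  assumes "M extreme_point_of magic_polytope D"
  shows "permutation_matrix M"
proof (rule extreme_point_birkhoff_permutation)
  show "M extreme_point_of birkhoff_polytope"
    using assms extreme_point_of_face[OF magic_polytope_face_of_birkhoff[of D], of M] by blast
qed

section \<open>Positivity of digraphs\<close>

text \<open>The graph of a permutation inside \<open>D\<close> is a perfect matching of the
  bipartite graph, and the indicator of a perfect matching has all vertex sums 1.\<close>

lemma positive_digraph_if_permutations:
  fixes D :: "'n::finite digraph"
  assumes "\<And>i j. (i, j) \<in> D \<Longrightarrow> \<exists>p. p permutes UNIV \<and> (\<forall>a. (a, p a) \<in> D) \<and> p i = j"
  shows "positive_digraph D"
  unfolding positive_digraph_def positive_graph_def
proof
  fix e assume "e \<in> bipartite_edges D"
  then obtain i j where e: "e = {Inl i, Inr j}" and "(i, j) \<in> D"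
    by (auto simp: bipartite_edges_def)
  then obtain p where p: "p permutes UNIV" "\<And>a. (a, p a) \<in> D" "p i = j"
    using assms by metis
  define Q where "Q = range (\<lambda>a. {Inl a, Inr (p a)} :: ('n + 'n) set)"
  have "(\<Sum>e' | e' \<in> bipartite_edges D \<and> v \<in> e'. if e' \<in> Q then 1 else 0) = (1::nat)" for v
  proof -
    \<comment> \<open>Every vertex lies on exactly one edge of the matching \<open>Q\<close>; for
      \<open>Inr c\<close> its other end is the preimage of \<open>c\<close> under
      \<open>p\<close>.\<close>
    obtain a where a: "\<And>b. v \<in> {Inl b, Inr (p b)} \<longleftrightarrow> b = a"
    proof (cases v)
      case (Inl a)
      then show ?thesis using that[of a] by auto
    next
      case (Inr c)
      have "bij p" using p(1) by (rule permutes_bij)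
      then obtain a where "\<And>b. c = p b \<longleftrightarrow> b = a" by (metis bij_pointE)
      then show ?thesis using that[of a] Inr by auto
    qed
    have "e' \<in> bipartite_edges D \<and> v \<in> e' \<and> e' \<in> Q \<longleftrightarrow> e' = {Inl a, Inr (p a)}" for e'
    proof
      assume e': "e' \<in> bipartite_edges D \<and> v \<in> e' \<and> e' \<in> Q"
      then obtain b where "e' = {Inl b, Inr (p b)}" by (auto simp: Q_def)
      then show "e' = {Inl a, Inr (p a)}" using a e' by metis
    next
      assume e': "e' = {Inl a, Inr (p a)}"
      have "e' \<in> bipartite_edges D" using p(2) e' unfolding bipartite_edges_def by blast
      moreover have "v \<in> e'" using a e' by metis
      moreover have "e' \<in> Q" using e' by (simp add: Q_def)
      ultimately show "e' \<in> bipartite_edges D \<and> v \<in> e' \<and> e' \<in> Q" by simp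
    qed
    then have "{e'. e' \<in> bipartite_edges D \<and> v \<in> e'} \<inter> {e'. e' \<in> Q} = {{Inl a, Inr (p a)}}"
      by (simp add: set_eq_iff)
    then show ?thesis by (simp add: sum.If_cases)
  qed
  moreover have "e \<in> Q" using e p(3) by (auto simp: Q_def)
  ultimately show "\<exists>L :: ('n + 'n) set \<Rightarrow> nat.
      (\<exists>r. \<forall>v\<in>UNIV. (\<Sum>e' | e' \<in> bipartite_edges D \<and> v \<in> e'. L e') = r) \<and> 0 < L e"
    by (intro exI[of _ "\<lambda>e'. if e' \<in> Q then 1 else 0"]) auto
qed

lemma positive_digraph_if_supported:
  fixes D :: "'n::finite digraph"
  assumes "\<And>i j. (i, j) \<in> D \<Longrightarrow> \<exists>M\<in>magic_polytope D. 0 < M $ i $ j"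
  shows "positive_digraph D"
proof (rule positive_digraph_if_permutations)
  fix i j assume "(i, j) \<in> D"
  then obtain M where M: "M \<in> magic_polytope D" "0 < M $ i $ j" using assms by blast
  have conv: "convex (magic_polytope D)"
    using magic_polytope_face_of_birkhoff face_of_imp_convex by blast
  \<comment> \<open>An entry that is zero at all extreme points is zero on their convex hull, which
    is the whole polytope by Krein--Milman.\<close>
  have "\<exists>X. X extreme_point_of magic_polytope D \<and> X $ i $ j \<noteq> 0"
  proof (rule ccontr)
    assume "\<not> ?thesis"
    then have "{X. X extreme_point_of magic_polytope D} \<subseteq> {X. X $ i $ j = 0}" by auto
    moreover have "convex {X :: real ^ 'n ^ 'n. X $ i $ j = 0}" by (simp add: convex_def)
    ultimately have "convex hull {X. X extreme_point_of magic_polytope D} \<subseteq> {X. X $ i $ j = 0}"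
      by (rule hull_minimal)
    then show False
      using M Krein_Milman_Minkowski[OF compact_magic_polytope conv] by auto
  qed
  then obtain X where X: "X extreme_point_of magic_polytope D" "X $ i $ j \<noteq> 0" by blast
  then obtain p where p: "p permutes UNIV" "X = (\<chi> i j. if j = p i then 1 else 0)"
    using extreme_point_magic_permutation unfolding permutation_matrix_def by blast
  have "X \<in> magic_polytope D" using X(1) by (simp add: extreme_point_of_def)
  then have "X $ a $ p a \<noteq> 0 \<longrightarrow> (a, p a) \<in> D" for a unfolding magic_polytope_eq by blast
  then have "\<forall>a. (a, p a) \<in> D" by (simp add: p(2))
  moreover have "p i = j" using X(2) p(2) by (auto split: if_splits)
  ultimately show "\<exists>p. p permutes UNIV \<and> (\<forall>a. (a, p a) \<in> D) \<and> p i = j" using p(1) by blast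
qed

section \<open>Faces as polytopes of magic labelings\<close>

text \<open>From a point positive on all of \<open>D\<close>, a small step along any zero-sum
  direction stays in the polytope, so the differences from that point span all these
  directions.\<close>

lemma dim_zero_sum_le_aff_dim:
  fixes x :: "real ^ 'n ^ 'n"
  assumes x: "x \<in> magic_polytope D" and pos: "\<And>i j. (i, j) \<in> D \<Longrightarrow> 0 < x $ i $ j"
  shows "int (dim (zero_sum_matrices D)) \<le> aff_dim (magic_polytope D)"
proof -
  have B: "x \<in> birkhoff_polytope" using x by (simp add: magic_polytope_eq)
  let ?T = "(+) (- x) ` magic_polytope D"
  have "w \<in> span ?T" if w: "w \<in> zero_sum_matrices D" for w
  proof -
    have "D \<subseteq> {(i, j). 0 < x $ i $ j}" using pos by auto
    then have "w \<in> zero_sum_matrices {(i, j). 0 < x $ i $ j}"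
      using w zero_sum_matrices_mono by blast
    then obtain e where e: "0 < e" "x + e *\<^sub>R w \<in> birkhoff_polytope"
      using birkhoff_perturb[OF B] by (metis abs_of_pos order_refl)
    then have "x + e *\<^sub>R w \<in> magic_polytope D"
      using x w by (simp add: magic_polytope_eq zero_sum_matrices_def)
    then have "e *\<^sub>R w \<in> ?T" by force
    then have "(1 / e) *\<^sub>R e *\<^sub>R w \<in> span ?T" by (intro span_scale span_base)
    then show ?thesis using e(1) by simp
  qed
  then have "dim (zero_sum_matrices D) \<le> dim ?T" by (intro dim_mono) blast
  then show ?thesis using aff_dim_eq_dim[of x] hull_inc[OF x] by simp
qed

lemma face_of_birkhoff_eq_magic_polytope:
  fixes F :: "(real ^ 'n ^ 'n) set"
  assumes F: "F face_of birkhoff_polytope" "F \<noteq> {}"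
  obtains D x where "F = magic_polytope D" "D \<noteq> {}" "x \<in> F" "\<And>i j. (i, j) \<in> D \<Longrightarrow> 0 < x $ i $ j"
proof -
  define D where "D = {(i, j). \<exists>M\<in>F. 0 < M $ i $ j}"
  have FB: "F \<subseteq> birkhoff_polytope" and conv: "convex F"
    using F(1) face_of_imp_subset face_of_imp_convex by blast+
  have nn: "0 \<le> M $ i $ j" if "M \<in> F" for M i j
    using FB that by (auto simp: birkhoff_polytope_def)
  obtain M0 where M0: "M0 \<in> F" using F(2) by blast
  \<comment> \<open>Row sums are 1, so the zero matrix is excluded. Nonemptiness is needed for the
    average over \<open>D\<close> below and for the dimension bound.\<close>
  have "D \<noteq> {}"
  proof
    assume "D = {}"
    then have "\<not> 0 < M0 $ i $ j" for i j using M0 by (auto simp: D_def)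
    then have "M0 $ i $ j = 0" for i j using nn[OF M0, of i j] by (simp add: less_le)
    then show False using M0 FB by (auto simp: birkhoff_polytope_def)
  qed
  have "\<forall>q\<in>D. \<exists>M. M \<in> F \<and> 0 < M $ fst q $ snd q" by (auto simp: D_def)
  then obtain m where m: "\<And>q. q \<in> D \<Longrightarrow> m q \<in> F \<and> 0 < m q $ fst q $ snd q"
    by metis
  \<comment> \<open>Averaging one witness per position gives a point of \<open>F\<close> that is
    positive at every position of \<open>D\<close>.\<close>
  define x where "x = (\<Sum>q\<in>D. (1 / card D) *\<^sub>R m q)"
  have x: "x \<in> F"
    unfolding x_def using m \<open>D \<noteq> {}\<close> by (intro convex_sum[OF _ conv]) auto
  have pos: "0 < x $ i $ j" if "(i, j) \<in> D" for i j
  proof -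
    have "0 < (\<Sum>q\<in>D. 1 / card D * m q $ i $ j)"
      using m[OF that] m nn that \<open>D \<noteq> {}\<close>
      by (intro sum_pos2[of D "(i, j)"]) (auto simp: card_gt_0_iff)
    then show ?thesis by (simp add: x_def)
  qed
  have "F \<subseteq> magic_polytope D"
    using FB nn by (force simp: magic_polytope_eq D_def less_le)
  moreover have "y \<in> F" if y: "y \<in> magic_polytope D" for y
  proof (cases "y = x")
    case False
    have yB: "y \<in> birkhoff_polytope" using y by (simp add: magic_polytope_eq)
    have xB: "x \<in> birkhoff_polytope" using x FB by blast
    have "x \<in> magic_polytope D" using x \<open>F \<subseteq> magic_polytope D\<close> by blast
    then have "x - y \<in> zero_sum_matrices D"
      using y by (auto simp: magic_polytope_eq zero_sum_matrices_def birkhoff_polytope_def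
          sum_subtractf)
    moreover have "D \<subseteq> {(i, j). 0 < x $ i $ j}" using pos by auto
    ultimately have "x - y \<in> zero_sum_matrices {(i, j). 0 < x $ i $ j}"
      using zero_sum_matrices_mono by blast
    then obtain e where e: "0 < e" "x + e *\<^sub>R (x - y) \<in> birkhoff_polytope"
      using birkhoff_perturb[OF xB] by (metis abs_of_pos order_refl)
    \<comment> \<open>Extending the segment from \<open>y\<close> slightly beyond \<open>x\<close>
      to \<open>?z\<close> makes \<open>x\<close> an interior point of it, so the face property puts
      \<open>y\<close> into \<open>F\<close>. The weight \<open>u\<close> solves
      \<open>x = (1 - u) *\<^sub>R y + u *\<^sub>R ?z\<close>.\<close>
    let ?z = "x + e *\<^sub>R (x - y)"
    define u where "u = 1 / (1 + e)"
    have u: "0 < u" "u < 1" "u + u * e = 1" using e(1) by (simp_all add: u_def field_simps)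
    have "(1 - u) *\<^sub>R y + u *\<^sub>R ?z = (1 - (u + u * e)) *\<^sub>R y + (u + u * e) *\<^sub>R x"
      by (simp add: algebra_simps)
    then have "x = (1 - u) *\<^sub>R y + u *\<^sub>R ?z" using u(3) by simp
    moreover have "y \<noteq> ?z"
    proof
      assume "y = ?z"
      then have "(1 + e) *\<^sub>R (x - y) = 0" by (simp add: algebra_simps)
      then show False using e(1) False by simp
    qed
    ultimately have "x \<in> open_segment y ?z"
      unfolding in_segment using u(1,2) by blast
    then show ?thesis using F(1) x yB e(2) unfolding face_of_def by blast
  qed (use x in simp)
  ultimately have "F = magic_polytope D" by blast
  then show thesis using that \<open>D \<noteq> {}\<close> x pos by blast
qed

theorem theorem1p5p6:
  shows "magic_polytope (complete_digraph :: 'n::finite digraph) = birkhoff_polytope \<and>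
    (\<forall>d::nat.
      {F :: (real ^ 'n ^ 'n) set. F face_of birkhoff_polytope \<and> F \<noteq> {} \<and> aff_dim F = int d} =
      {magic_polytope D | D :: 'n digraph. positive_digraph D \<and>
         card D \<le> 2 * CARD('n) + d - 1 \<and> aff_dim (magic_polytope D) = int d}) \<and>
    (\<forall>D :: 'n digraph. positive_digraph D \<longrightarrow>
      (\<forall>M. M extreme_point_of magic_polytope D \<longrightarrow> permutation_matrix M))"
proof (intro conjI allI impI)
  show "magic_polytope (complete_digraph :: 'n digraph) = birkhoff_polytope"
    by (simp add: magic_polytope_eq complete_digraph_def)
next
  fix d :: nat
  have "\<exists>D :: 'n digraph. F = magic_polytope D \<and> positive_digraph D \<and>
      card D \<le> 2 * CARD('n) + d - 1"
    if F: "F face_of birkhoff_polytope" "F \<noteq> {}" "aff_dim F = int d" for F :: "(real ^ 'n ^ 'n) set"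
  proof -
    obtain D x where D: "F = magic_polytope D" "D \<noteq> {}" "x \<in> F"
      "\<And>i j. (i, j) \<in> D \<Longrightarrow> 0 < x $ i $ j"
      using face_of_birkhoff_eq_magic_polytope[OF F(1,2)] by metis
    then have "positive_digraph D" by (intro positive_digraph_if_supported) auto
    moreover have "dim (zero_sum_matrices D) \<le> d"
      using dim_zero_sum_le_aff_dim[of x D] D F(3) by auto
    moreover have "card (fst ` D) \<le> CARD('n)" "card (snd ` D) \<le> CARD('n)"
      by (auto intro: card_mono)
    \<comment> \<open>With \<open>n = CARD('n)\<close>, the bounds give
      \<open>card D + 1 \<le> d + 2 * n\<close>; the truncated subtraction in the goal is harmless
      because \<open>n\<close> is at least 1.\<close>
    ultimately show ?thesis using D(1) dim_zero_sum_matrices[OF D(2)] by (intro exI[of _ D]) auto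
  qed
  \<comment> \<open>The empty set has affine dimension -1, so prescribing \<open>int d\<close>
    supplies the nonemptiness demanded of faces.\<close>
  moreover have "magic_polytope D \<noteq> {}" if "aff_dim (magic_polytope D) = int d"
    for D :: "'n digraph"
    using that by auto
  ultimately show "{F :: (real ^ 'n ^ 'n) set. F face_of birkhoff_polytope \<and> F \<noteq> {} \<and>
        aff_dim F = int d} =
      {magic_polytope D | D :: 'n digraph. positive_digraph D \<and>
         card D \<le> 2 * CARD('n) + d - 1 \<and> aff_dim (magic_polytope D) = int d}"
    using magic_polytope_face_of_birkhoff by blast
qed (rule extreme_point_magic_permutation)

end
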